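(* Let $n\ge1$, $\gamma_1,\dots,\gamma_n>0$, $\alpha\in[0,1]$, $\epsilon>0$, and let $G$ be a CDF on $\mathbb{R}$ with finite second moment, mean $\mu_G$ and standard deviation $\sigma_G>0$. Consider the $\alpha$-maxmin risk sharing problem $$\inf_{\{X_i\}_{i=1}^n\in\mathcal{S}(X)}\left\{\alpha\sup_{F_w\in\mathcal{M}^2(G;\epsilon)}\sum_{i=1}^nV_i^{F_w}(X_i;\gamma_i)+(1-\alpha)\inf_{F_b\in\mathcal{M}^2(G;\epsilon)}\sum_{i=1}^nV_i^{F_b}(X_i;\gamma_i)\right\}.$$ Then optimal allocated risks $X_1^*,\dots,X_n^*$ are given by $$X_i^*=\frac{1/\gamma_i}{\sum_{j=1}^n1/\gamma_j}X+\beta_i,\qquad i=1,\dots,n,$$ where $\beta_1,\dots,\beta_n\in\mathbb{R}$ satisfy $\sum_{i=1}^n\beta_i=0$. With $\bar\gamma=\left(\sum_{i=1}^n1/\gamma_i\right)^{-1}$, the quantile functions of $X$ corresponding to the worst-case and best-case probability measures (those giving the supremum over $F_w$ and the infimum over $F_b$, respectively, at the optimal allocation) are $$F_{wo}^{-1}(t)=(\mu_G+\sqrt{\epsilon}\cos\theta_w)+(\sigma_G+\sqrt{\epsilon}\sin\theta_w)\frac{G^{-1}(t)-\mu_G}{\sigma_G},$$ $$F_{be}^{-1}(t)=(\mu_G+\sqrt{\epsilon}\cos\theta_b)+(\sigma_G+\sqrt{\epsilon}\sin\theta_b)\frac{G^{-1}(t)-\mu_G}{\sigma_G},$$ where $\theta_w$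 and $\theta_b$ are the unique roots in $(0,\pi/2)$ and in $(\pi,3\pi/2)$, respectively, of $\tan\theta-2\bar\gamma\sigma_G-2\bar\gamma\sqrt{\epsilon}\sin\theta=0$.
   Context: For a CDF $F$, $F^{-1}(t)=\inf\{x:F(x)\ge t\}$; $W_2(F,G)=\left(\int_0^1|F^{-1}(t)-G^{-1}(t)|^2dt\right)^{1/2}$; $\mathcal{M}^2(G;\epsilon)$ is the set of all CDFs $F$ on $\mathbb{R}$ with finite second moment and $W_2(F,G)\le\sqrt{\epsilon}$. $(\Omega,\mathscr{F},\mathbb{P})$ is an atomless probability space and $\mathcal{L}^2$ is the class of real-valued random variables on it with finite second moments. $X$ is the aggregate loss to be allocated among $n$ agents; it has finite second moment under any probability measure considered. The set of feasible allocations is $\mathcal{S}(X)=\left\{\{X_i\}_{i=1}^n\in(\mathcal{L}^2)^n:\ \sum_{i=1}^nX_i=X\right\}$. Beliefs are homogeneous: all agents use the same probability measure, and $F$ denotes the CDF of $X$ under that common measure. Agent $i$ evaluates her allocated loss $X_i$ by the mean-variance functional $V_i^F(X_i;\gamma_i)=\mathbb{E}[X_i]+\gamma_i\mathbb{V}[X_i]$, with mean and variance taken under the common measure under which $X$ has CDF $F$; $\gamma_i$ is agent $i$'s variance-aversion parameter. Uncertainty about the distribution of $X$ is described by the ball $\mathcal{M}^2(G;\epsilon)$; the CDFs $F_w$ and $F_b$ belong to this ball but need not coincide. The parameter $\alpha$ is the weight on the worst-case evaluation. *)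

theory Defs
  imports "HOL-Probability.Probability"
begin

subsection \<open>Distribution functions and the Wasserstein ball\<close>

definition is_cdf :: "(real \<Rightarrow> real) \<Rightarrow> bool" where
  "is_cdf F \<longleftrightarrow> mono F \<and> (\<forall>x. continuous (at_right x) F)
     \<and> (F \<longlongrightarrow> 0) at_bot \<and> (F \<longlongrightarrow> 1) at_top"

definition cdf_finite_second_moment :: "(real \<Rightarrow> real) \<Rightarrow> bool" where
  "cdf_finite_second_moment F \<longleftrightarrow> integrable (interval_measure F) (\<lambda>x. x\<^sup>2)"

definition cdf_mean :: "(real \<Rightarrow> real) \<Rightarrow> real" where
  "cdf_mean F = (\<integral>x. x \<partial>interval_measure F)"

definition cdf_sd :: "(real \<Rightarrow> real) \<Rightarrow> real" where
  "cdf_sd F = sqrt (\<integral>x. (x - cdf_mean F)\<^sup>2 \<partial>interval_measure F)"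

text \<open>Only meaningful for \<open>0 < t < 1\<close>, where the set is nonempty and bounded below.\<close>

definition quantile :: "(real \<Rightarrow> real) \<Rightarrow> real \<Rightarrow> real" where
  "quantile F t = Inf {x. F x \<ge> t}"

text \<open>The endpoints, where quantiles may be infinite, are left out of the integral. The integrand
  is integrable as soon as both distribution functions have finite second moments, which is the
  only case in which \<open>W2\<close> is used.\<close>

definition W2 :: "(real \<Rightarrow> real) \<Rightarrow> (real \<Rightarrow> real) \<Rightarrow> real" where
  "W2 F G = sqrt (LBINT t:{0<..<1}. \<bar>quantile F t - quantile G t\<bar>\<^sup>2)"

definition wasserstein_ball :: "(real \<Rightarrow> real) \<Rightarrow> real \<Rightarrow> (real \<Rightarrow> real) set" where
  "wasserstein_ball G \<epsilon> =
     {F. is_cdf F \<and> cdf_finite_second_moment F \<and> W2 F G \<le> sqrt \<epsilon>}"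

subsection \<open>Risk sharing\<close>

definition atomless :: "'w measure \<Rightarrow> bool" where
  "atomless M \<longleftrightarrow> (\<forall>A\<in>sets M. measure M A > 0 \<longrightarrow>
     (\<exists>B\<in>sets M. B \<subseteq> A \<and> 0 < measure M B \<and> measure M B < measure M A))"

definition L2 :: "'w measure \<Rightarrow> ('w \<Rightarrow> real) set" where
  "L2 M = {Y \<in> borel_measurable M. integrable M (\<lambda>\<omega>. (Y \<omega>)\<^sup>2)}"

definition allocations :: "'w measure \<Rightarrow> nat \<Rightarrow> ('w \<Rightarrow> real) \<Rightarrow> (nat \<Rightarrow> 'w \<Rightarrow> real) set" where
  "allocations P n X =
     {Y. (\<forall>i\<in>{1..n}. Y i \<in> L2 P) \<and> (\<forall>\<omega>\<in>space P. (\<Sum>i=1..n. Y i \<omega>) = X \<omega>)}"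

text \<open>An allocation is square integrable under the reference measure, but not necessarily under
  every other measure at which it is evaluated. Outside \<open>L2 M\<close> the variance is infinite
  or undefined, and the loss is evaluated as \<open>\<infinity>\<close>.\<close>

definition mean_variance :: "'w measure \<Rightarrow> real \<Rightarrow> ('w \<Rightarrow> real) \<Rightarrow> ereal" where
  "mean_variance M c Y =
     (if Y \<in> L2 M then ereal (prob_space.expectation M Y + c * prob_space.variance M Y) else \<infinity>)"

text \<open>Here and below \<open>Q F\<close> is the probability measure, common to all agents, under which the
  aggregate loss has distribution function \<open>F\<close>.\<close>

definition total_evaluation ::
    "((real \<Rightarrow> real) \<Rightarrow> 'w measure) \<Rightarrow> nat \<Rightarrow> (nat \<Rightarrow> real) \<Rightarrow> (nat \<Rightarrow> 'w \<Rightarrow> real) \<Rightarrow> (real \<Rightarrow> real) \<Rightarrow> ereal"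
  where
  "total_evaluation Q n \<gamma> Y F = (\<Sum>i=1..n. mean_variance (Q F) (\<gamma> i) (Y i))"

definition alpha_maxmin ::
    "((real \<Rightarrow> real) \<Rightarrow> 'w measure) \<Rightarrow> (real \<Rightarrow> real) set \<Rightarrow> real \<Rightarrow> nat \<Rightarrow> (nat \<Rightarrow> real)
       \<Rightarrow> (nat \<Rightarrow> 'w \<Rightarrow> real) \<Rightarrow> ereal"
  where
  "alpha_maxmin Q \<M> \<alpha> n \<gamma> Y =
     ereal \<alpha> * (SUP F\<in>\<M>. total_evaluation Q n \<gamma> Y F)
     + ereal (1 - \<alpha>) * (INF F\<in>\<M>. total_evaluation Q n \<gamma> Y F)"

end

theory Submission
  imports Defs
begin

text \<open>By Cauchy--Schwarz, \<open>Var (\<Sum>i. Y i) \<le> (\<Sum>i. 1 / \<gamma> i) * (\<Sum>i. \<gamma> i * Var (Y i))\<close>, with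
  equality for the proportional allocation. Hence, for every distribution in the ball
  simultaneously, that allocation minimises the total evaluation, and so it minimises every
  combination of supremum and infimum with nonnegative weights.

  Its total evaluation is \<open>E q + \<gamma>bar * Var q\<close>, where \<open>q\<close> is the quantile function of \<open>X\<close>
  as a random variable on \<open>(0, 1)\<close>, and the ball is a constraint on the squared \<open>L\<^sup>2\<close> distance
  from \<open>q\<close> to the quantile function of \<open>G\<close>. The equation for \<open>\<theta>\<close> is the first-order condition with
  Lagrange multiplier \<open>1 / (2 * sqrt \<epsilon> * cos \<theta>)\<close>. Since the functional and the constraint are both
  quadratic, the Lagrangian minus its value at the stationary point is an exact quadratic form. It
  is negative definite for \<open>\<theta>\<close> in \<open>(0, pi/2)\<close>, where the multiplier exceeds \<open>\<gamma>bar\<close>, and positive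
  definite for \<open>\<theta>\<close> in \<open>(pi, 3*pi/2)\<close>, where the multiplier is negative. This gives both optimality and
  uniqueness.\<close>

section \<open>Square integrable random variables\<close>

context prob_space
begin

lemma L2_measurable: "Y \<in> L2 M \<Longrightarrow> Y \<in> borel_measurable M"
  by (simp add: L2_def)

lemma L2_square_integrable: "Y \<in> L2 M \<Longrightarrow> integrable M (\<lambda>\<omega>. (Y \<omega>)\<^sup>2)"
  by (simp add: L2_def)

lemma L2_integrable: "Y \<in> L2 M \<Longrightarrow> integrable M Y"
  unfolding L2_def by (blast intro: square_integrable_imp_integrable)

lemma L2_mult_integrable:
  assumes "Y \<in> L2 M" "Z \<in> L2 M"
  shows "integrable M (\<lambda>\<omega>. Y \<omega> * Z \<omega>)"
proof (rule Bochner_Integration.integrable_bound)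
  show "integrable M (\<lambda>\<omega>. (Y \<omega>)\<^sup>2 + (Z \<omega>)\<^sup>2)"
    using assms by (intro Bochner_Integration.integrable_add L2_square_integrable)
  show "(\<lambda>\<omega>. Y \<omega> * Z \<omega>) \<in> borel_measurable M"
    using assms by (intro borel_measurable_times L2_measurable)
  have "\<bar>y * z\<bar> \<le> y\<^sup>2 + z\<^sup>2" for y z :: real
    using sum_squares_bound[of "\<bar>y\<bar>" "\<bar>z\<bar>"] abs_ge_zero[of "y * z"]
    unfolding abs_mult power2_abs by linarith
  then show "AE \<omega> in M. norm (Y \<omega> * Z \<omega>) \<le> norm ((Y \<omega>)\<^sup>2 + (Z \<omega>)\<^sup>2)"
    by (intro AE_I2) (simp add: abs_mult)
qed

lemma L2_const: "(\<lambda>_. c) \<in> L2 M"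
  by (simp add: L2_def)

lemma L2_add:
  assumes "Y \<in> L2 M" "Z \<in> L2 M"
  shows "(\<lambda>\<omega>. Y \<omega> + Z \<omega>) \<in> L2 M"
proof -
  have "integrable M (\<lambda>\<omega>. (Y \<omega>)\<^sup>2 + 2 * (Y \<omega> * Z \<omega>) + (Z \<omega>)\<^sup>2)"
    using assms by (intro Bochner_Integration.integrable_add L2_square_integrable
        integrable_mult_right L2_mult_integrable)
  then show ?thesis
    using assms borel_measurable_add[of Y M Z] by (simp add: L2_def power2_sum algebra_simps)
qed

lemma L2_mult: "Y \<in> L2 M \<Longrightarrow> (\<lambda>\<omega>. c * Y \<omega>) \<in> L2 M"
  by (auto simp: L2_def power_mult_distrib)

lemma L2_diff:
  assumes "Y \<in> L2 M" "Z \<in> L2 M"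
  shows "(\<lambda>\<omega>. Y \<omega> - Z \<omega>) \<in> L2 M"
  using L2_add[OF assms(1) L2_mult[OF assms(2), of "-1"]] by simp

lemma L2_sum:
  assumes "finite A" "\<And>i. i \<in> A \<Longrightarrow> Y i \<in> L2 M"
  shows "(\<lambda>\<omega>. \<Sum>i\<in>A. Y i \<omega>) \<in> L2 M"
  using assms by (induction A rule: finite_induct) (auto intro: L2_add L2_const)

lemma L2_cong: "(\<And>\<omega>. \<omega> \<in> space M \<Longrightarrow> Y \<omega> = Z \<omega>) \<Longrightarrow> Y \<in> L2 M \<longleftrightarrow> Z \<in> L2 M"
  using measurable_cong[of M Y Z borel]
    Bochner_Integration.integrable_cong[of M M "\<lambda>\<omega>. (Y \<omega>)\<^sup>2" "\<lambda>\<omega>. (Z \<omega>)\<^sup>2"]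
  by (simp add: L2_def)

lemma expectation_affine_L2:
  assumes "Y \<in> L2 M"
  shows "expectation (\<lambda>\<omega>. a * Y \<omega> + b) = a * expectation Y + b"
  using L2_integrable[OF assms] prob_space by simp

lemma variance_affine_L2:
  assumes "Y \<in> L2 M"
  shows "variance (\<lambda>\<omega>. a * Y \<omega> + b) = a\<^sup>2 * variance Y"
proof -
  have "variance (\<lambda>\<omega>. a * Y \<omega> + b) = expectation (\<lambda>\<omega>. a\<^sup>2 * (Y \<omega> - expectation Y)\<^sup>2)"
    unfolding expectation_affine_L2[OF assms]
    by (simp add: power_mult_distrib[symmetric] right_diff_distrib)
  then show ?thesis by simp
qed

lemma mean_variance_L2:
  "Y \<in> L2 M \<Longrightarrow> mean_variance M c Y = ereal (expectation Y + c * variance Y)"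
  by (simp add: mean_variance_def)

end

section \<open>Dependence on the law alone\<close>

lemma L2_distr_iff:
  assumes [measurable]: "Y \<in> borel_measurable M"
  shows "Y \<in> L2 M \<longleftrightarrow> integrable (distr M borel Y) (\<lambda>x. x\<^sup>2)"
  by (simp add: L2_def integrable_distr_eq)

text \<open>The two underlying spaces may differ. This is what lets \<open>X\<close> under
  \<open>Q F\<close> be replaced by the quantile function of \<open>F\<close> on the unit
  interval.\<close>

lemma mean_variance_distr_cong:
  assumes [measurable]: "Y \<in> borel_measurable M" "Z \<in> borel_measurable N"
    and eq: "distr M borel Y = distr N borel Z"
  shows "mean_variance M c Y = mean_variance N c Z"
proof -
  have E: "(\<integral>\<omega>. f (Y \<omega>) \<partial>M) = (\<integral>\<omega>. f (Z \<omega>) \<partial>N)"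
    if "f \<in> borel_measurable borel" for f :: "real \<Rightarrow> real"
    using that integral_distr[of Y M borel f] integral_distr[of Z N borel f] by (simp add: eq)
  have "Y \<in> L2 M \<longleftrightarrow> Z \<in> L2 N"
    by (simp add: L2_distr_iff eq)
  moreover have "(\<integral>\<omega>. Y \<omega> \<partial>M) = (\<integral>\<omega>. Z \<omega> \<partial>N)"
    using E[of "\<lambda>x. x"] by simp
  moreover have "(\<integral>\<omega>. (Y \<omega> - m)\<^sup>2 \<partial>M) = (\<integral>\<omega>. (Z \<omega> - m)\<^sup>2 \<partial>N)" for m
    using E[of "\<lambda>x. (x - m)\<^sup>2"] by simp
  ultimately show ?thesis
    by (simp add: mean_variance_def)
qed

section \<open>Optimality of proportional risk sharing\<close>

context prob_space
begin

text \<open>Cauchy-Schwarz is applied pointwise to the centred variables, with the factor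
  \<open>1 / sqrt (\<gamma> i)\<close> split off, and then integrated, so covariances never
  appear.\<close>

lemma variance_sum_le:
  assumes fin: "finite A" and pos: "\<And>i. i \<in> A \<Longrightarrow> \<gamma> i > (0::real)"
    and Y: "\<And>i. i \<in> A \<Longrightarrow> Y i \<in> L2 M"
  shows "variance (\<lambda>\<omega>. \<Sum>i\<in>A. Y i \<omega>) \<le> (\<Sum>i\<in>A. 1 / \<gamma> i) * (\<Sum>i\<in>A. \<gamma> i * variance (Y i))"
proof -
  define Z where "Z i \<omega> = Y i \<omega> - expectation (Y i)" for i \<omega>
  have Z: "Z i \<in> L2 M" if "i \<in> A" for i
    unfolding Z_def using that Y by (intro L2_diff L2_const)
  have CS: "(\<Sum>i\<in>A. Z i \<omega>)\<^sup>2 \<le> (\<Sum>i\<in>A. 1 / \<gamma> i) * (\<Sum>i\<in>A. \<gamma> i * (Z i \<omega>)\<^sup>2)" for \<omega>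
  proof -
    have "(\<Sum>i\<in>A. 1 / sqrt (\<gamma> i) * (sqrt (\<gamma> i) * Z i \<omega>))\<^sup>2
        \<le> (\<Sum>i\<in>A. (1 / sqrt (\<gamma> i))\<^sup>2) * (\<Sum>i\<in>A. (sqrt (\<gamma> i) * Z i \<omega>)\<^sup>2)"
      by (rule Cauchy_Schwarz_ineq_sum)
    also have "(\<Sum>i\<in>A. 1 / sqrt (\<gamma> i) * (sqrt (\<gamma> i) * Z i \<omega>)) = (\<Sum>i\<in>A. Z i \<omega>)"
      using pos by (intro sum.cong) force+
    also have "(\<Sum>i\<in>A. (1 / sqrt (\<gamma> i))\<^sup>2) = (\<Sum>i\<in>A. 1 / \<gamma> i)"
      using pos by (intro sum.cong) (auto simp: power_divide less_imp_le)
    also have "(\<Sum>i\<in>A. (sqrt (\<gamma> i) * Z i \<omega>)\<^sup>2) = (\<Sum>i\<in>A. \<gamma> i * (Z i \<omega>)\<^sup>2)"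
      using pos by (intro sum.cong) (auto simp: power_mult_distrib less_imp_le)
    finally show ?thesis .
  qed
  have "expectation (\<lambda>\<omega>. \<Sum>i\<in>A. Y i \<omega>) = (\<Sum>i\<in>A. expectation (Y i))"
    using Y by (intro Bochner_Integration.integral_sum L2_integrable)
  then have "variance (\<lambda>\<omega>. \<Sum>i\<in>A. Y i \<omega>) = expectation (\<lambda>\<omega>. (\<Sum>i\<in>A. Z i \<omega>)\<^sup>2)"
    by (simp add: Z_def sum_subtractf)
  also have "\<dots> \<le> expectation (\<lambda>\<omega>. (\<Sum>i\<in>A. 1 / \<gamma> i) * (\<Sum>i\<in>A. \<gamma> i * (Z i \<omega>)\<^sup>2))"
    using Z fin by (intro integral_mono CS)
       (auto intro!: L2_square_integrable L2_sum Bochner_Integration.integrable_sum)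
  also have "\<dots> = (\<Sum>i\<in>A. 1 / \<gamma> i) * (\<Sum>i\<in>A. expectation (\<lambda>\<omega>. \<gamma> i * (Z i \<omega>)\<^sup>2))"
    using Z by (subst integral_mult_right_zero, subst Bochner_Integration.integral_sum)
       (auto intro!: L2_square_integrable)
  finally show ?thesis
    by (simp add: Z_def)
qed

text \<open>The lower bound for arbitrary allocations; the weight on the left is the reciprocal of
  the Cauchy-Schwarz factor. The components are not assumed to be in \<open>L2 M\<close>, because
  \<open>M\<close> will be some \<open>Q F\<close>, while allocations are square integrable only
  under the reference measure.\<close>

lemma mean_variance_le_sum:
  assumes fin: "finite A" and ne: "A \<noteq> {}" and pos: "\<And>i. i \<in> A \<Longrightarrow> \<gamma> i > (0::real)"
    and X: "X \<in> L2 M" and sum: "\<And>\<omega>. \<omega> \<in> space M \<Longrightarrow> (\<Sum>i\<in>A. Y i \<omega>) = X \<omega>"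
  shows "mean_variance M (inverse (\<Sum>i\<in>A. 1 / \<gamma> i)) X \<le> (\<Sum>i\<in>A. mean_variance M (\<gamma> i) (Y i))"
proof (cases "\<forall>i\<in>A. Y i \<in> L2 M")
  \<comment> \<open>One component outside \<open>L2 M\<close> already makes the whole sum
    infinite.\<close>
  case False
  then obtain i where i: "i \<in> A" "mean_variance M (\<gamma> i) (Y i) = \<infinity>"
    by (auto simp: mean_variance_def)
  have "(\<Sum>i\<in>A. mean_variance M (\<gamma> i) (Y i)) = \<infinity>"
    using fin i by (auto simp: sum_Pinfty)
  then show ?thesis by simp
next
  case True
  then have Y: "Y i \<in> L2 M" if "i \<in> A" for i using that by blast
  define S where "S = (\<Sum>i\<in>A. 1 / \<gamma> i)"
  have S: "S > 0"
    unfolding S_def using fin ne pos by (intro sum_pos) auto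
  have eE: "expectation X = expectation (\<lambda>\<omega>. \<Sum>i\<in>A. Y i \<omega>)"
    by (intro Bochner_Integration.integral_cong) (auto simp: sum)
  have eV: "variance X = variance (\<lambda>\<omega>. \<Sum>i\<in>A. Y i \<omega>)"
    unfolding eE by (intro Bochner_Integration.integral_cong) (auto simp: sum)
  have "variance X \<le> S * (\<Sum>i\<in>A. \<gamma> i * variance (Y i))"
    unfolding eV S_def using fin pos Y by (rule variance_sum_le)
  then have "inverse S * variance X \<le> (\<Sum>i\<in>A. \<gamma> i * variance (Y i))"
    using S by (simp add: field_simps)
  moreover have "expectation X = (\<Sum>i\<in>A. expectation (Y i))"
    unfolding eE using Y by (intro Bochner_Integration.integral_sum L2_integrable)
  ultimately have "expectation X + inverse S * variance X
      \<le> (\<Sum>i\<in>A. expectation (Y i) + \<gamma> i * variance (Y i))"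
    by (simp add: sum.distrib)
  moreover have "(\<Sum>i\<in>A. mean_variance M (\<gamma> i) (Y i))
      = ereal (\<Sum>i\<in>A. expectation (Y i) + \<gamma> i * variance (Y i))"
    unfolding sum_ereal[symmetric] using Y by (intro sum.cong) (auto simp: mean_variance_L2)
  ultimately show ?thesis
    using X by (simp add: mean_variance_L2 S_def)
qed

text \<open>Shares proportional to \<open>1 / \<gamma> i\<close> are the equality case of
  Cauchy-Schwarz. The shifts leave the variances unchanged and cancel in the sum of the
  means.\<close>

lemma sum_mean_variance_proportional:
  assumes fin: "finite A" and ne: "A \<noteq> {}" and pos: "\<And>i. i \<in> A \<Longrightarrow> \<gamma> i > (0::real)"
    and X: "X \<in> L2 M" and \<beta>: "(\<Sum>i\<in>A. \<beta> i) = 0"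
  shows "(\<Sum>i\<in>A. mean_variance M (\<gamma> i) (\<lambda>\<omega>. (1 / \<gamma> i) / (\<Sum>j\<in>A. 1 / \<gamma> j) * X \<omega> + \<beta> i))
     = mean_variance M (inverse (\<Sum>i\<in>A. 1 / \<gamma> i)) X"
proof -
  define S where "S = (\<Sum>i\<in>A. 1 / \<gamma> i)"
  have S: "S > 0"
    unfolding S_def using fin ne pos by (intro sum_pos) auto
  have L: "(\<lambda>\<omega>. c * X \<omega> + d) \<in> L2 M" for c d
    by (intro L2_add L2_mult L2_const X)
  have "(\<Sum>i\<in>A. mean_variance M (\<gamma> i) (\<lambda>\<omega>. (1 / \<gamma> i) / S * X \<omega> + \<beta> i))
     = (\<Sum>i\<in>A. ereal ((1 / \<gamma> i) * (expectation X / S) + \<beta> i + (1 / \<gamma> i) * (variance X / S\<^sup>2)))"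
  proof (intro sum.cong refl)
    fix i assume "i \<in> A"
    then have "\<gamma> i > 0" by (rule pos)
    \<comment> \<open>One factor \<open>\<gamma> i\<close> cancels against the squared share, so the
      variance term keeps the weight \<open>1 / \<gamma> i\<close>; these weights sum to
      \<open>S\<close>, which leaves \<open>variance X / S\<close>.\<close>
    then have "(1 / \<gamma> i) / S * x + \<beta> i + \<gamma> i * (((1 / \<gamma> i) / S)\<^sup>2 * v)
      = (1 / \<gamma> i) * (x / S) + \<beta> i + (1 / \<gamma> i) * (v / S\<^sup>2)" for x v
      by (simp add: power_divide power_mult_distrib power2_eq_square[of "\<gamma> i"])
    then show "mean_variance M (\<gamma> i) (\<lambda>\<omega>. (1 / \<gamma> i) / S * X \<omega> + \<beta> i)
      = ereal ((1 / \<gamma> i) * (expectation X / S) + \<beta> i + (1 / \<gamma> i) * (variance X / S\<^sup>2))"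
      unfolding mean_variance_L2[OF L] variance_affine_L2[OF X]
      unfolding expectation_affine_L2[OF X]
      by simp
  qed
  also have "\<dots> = ereal (S * (expectation X / S) + S * (variance X / S\<^sup>2))"
    by (simp only: sum_ereal sum.distrib sum_distrib_right[symmetric] \<beta> S_def) simp
  also have "\<dots> = mean_variance M (inverse S) X"
    using S by (simp add: mean_variance_L2[OF X] power2_eq_square field_simps)
  finally show ?thesis by (simp add: S_def)
qed

end

section \<open>The quadratic functional near its extremal points\<close>

text \<open>No term linear in \<open>q - p\<close> remains, because \<open>p\<close> is a critical point of the Lagrangian.\<close>

lemma (in prob_space) mean_variance_expansion:
  assumes q: "q \<in> L2 M" and g: "g \<in> L2 M"
    and m: "m = expectation g" and s: "s\<^sup>2 = variance g" "s > 0" and e: "e > (0::real)"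
    and C: "cos \<theta> \<noteq> 0" and \<theta>: "tan \<theta> - 2 * c * s - 2 * c * e * sin \<theta> = 0"
    and p: "\<And>\<omega>. \<omega> \<in> space M \<Longrightarrow>
      p \<omega> = (m + e * cos \<theta>) + (s + e * sin \<theta>) * ((g \<omega> - m) / s)"
  shows "expectation (\<lambda>\<omega>. (p \<omega> - g \<omega>)\<^sup>2) = e\<^sup>2"
    and "expectation q + c * variance q = expectation p + c * variance p
      + (expectation (\<lambda>\<omega>. (q \<omega> - g \<omega>)\<^sup>2) - e\<^sup>2) / (2 * e * cos \<theta>)
      + c * variance (\<lambda>\<omega>. q \<omega> - p \<omega>)
      - expectation (\<lambda>\<omega>. (q \<omega> - p \<omega>)\<^sup>2) / (2 * e * cos \<theta>)"
proof -
  \<comment> \<open>With \<open>z\<close> the standardised \<open>g\<close>, the functions 1 and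
    \<open>z\<close> are orthonormal, and \<open>p\<close> and \<open>g\<close> have coordinates
    \<open>A\<close>, \<open>B\<close> and \<open>m\<close>, \<open>s\<close> with respect to
    them.\<close>
  define z where "z \<omega> = (g \<omega> - m) / s" for \<omega>
  define A where "A = m + e * cos \<theta>"
  define B where "B = s + e * sin \<theta>"
  have z_eq: "z = (\<lambda>\<omega>. 1 / s * g \<omega> + - m / s)"
    by (auto simp: z_def fun_eq_iff diff_divide_distrib)
  have z: "z \<in> L2 M"
    unfolding z_eq by (intro L2_add L2_mult L2_const g)
  have Ez: "expectation z = 0"
    unfolding z_eq expectation_affine_L2[OF g] by (simp add: m)
  have Vz: "variance z = 1"
    unfolding z_eq variance_affine_L2[OF g] s(1)[symmetric] using s(2) by (simp add: power_divide)
  have Ez2: "expectation (\<lambda>\<omega>. (z \<omega>)\<^sup>2) = 1"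
    using Vz by (simp add: Ez)
  \<comment> \<open>These three moments are all that the functional and the distances see of
    \<open>q\<close>.\<close>
  define a where "a = expectation q"
  define b where "b = expectation (\<lambda>\<omega>. (q \<omega>)\<^sup>2)"
  define k where "k = expectation (\<lambda>\<omega>. q \<omega> * z \<omega>)"
  note [simp] = L2_integrable[OF q] L2_integrable[OF z] L2_square_integrable[OF q]
    L2_square_integrable[OF z] L2_mult_integrable[OF q z] prob_space
  \<comment> \<open>Every second moment below is an instance of this formula; \<open>x = 0\<close>
    gives those without \<open>q\<close>.\<close>
  have quad: "expectation (\<lambda>\<omega>. (x * q \<omega> + u + v * z \<omega>)\<^sup>2)
      = x\<^sup>2 * b + u\<^sup>2 + v\<^sup>2 + 2 * x * u * a + 2 * x * v * k" for x u v
  proof -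
    have "(\<lambda>\<omega>. (x * q \<omega> + u + v * z \<omega>)\<^sup>2) = (\<lambda>\<omega>. x\<^sup>2 * (q \<omega>)\<^sup>2 + u\<^sup>2 + v\<^sup>2 * (z \<omega>)\<^sup>2
        + 2 * x * u * q \<omega> + 2 * x * v * (q \<omega> * z \<omega>) + 2 * u * v * z \<omega>)"
      by (auto simp: fun_eq_iff power2_eq_square algebra_simps)
    then show ?thesis
      by (simp add: Ez Ez2 a_def b_def k_def)
  qed
  have lin: "expectation (\<lambda>\<omega>. x * q \<omega> + u + v * z \<omega>) = x * a + u" for x u v
    by (simp add: Ez a_def)
  have pz: "p \<omega> = A + B * z \<omega>" if "\<omega> \<in> space M" for \<omega>
    using p[OF that] by (simp add: A_def B_def z_def)
  have gz: "g \<omega> = m + s * z \<omega>" for \<omega>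
    using s by (simp add: z_def)
  have Ep: "expectation p = A"
    using lin[of 0 A B] by (simp add: pz cong: Bochner_Integration.integral_cong)
  have Vp: "variance p = B\<^sup>2"
    using quad[of 0 0 B] unfolding Ep by (simp add: pz cong: Bochner_Integration.integral_cong)
  have Vq: "variance q = b - a\<^sup>2"
    using quad[of 1 "-a" 0] by (simp add: a_def power2_eq_square)
  have Dqg: "expectation (\<lambda>\<omega>. (q \<omega> - g \<omega>)\<^sup>2) = b + m\<^sup>2 + s\<^sup>2 - 2 * m * a - 2 * s * k"
    using quad[of 1 "-m" "-s"] by (simp add: gz algebra_simps)
  have Dqp: "expectation (\<lambda>\<omega>. (q \<omega> - p \<omega>)\<^sup>2) = b + A\<^sup>2 + B\<^sup>2 - 2 * A * a - 2 * B * k"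
    using quad[of 1 "-A" "-B"] by (simp add: pz algebra_simps cong: Bochner_Integration.integral_cong)
  have Eqp: "expectation (\<lambda>\<omega>. q \<omega> - p \<omega>) = a - A"
    using lin[of 1 "-A" "-B"] by (simp add: pz algebra_simps cong: Bochner_Integration.integral_cong)
  have Vqp: "variance (\<lambda>\<omega>. q \<omega> - p \<omega>) = b - a\<^sup>2 + B\<^sup>2 - 2 * B * k"
    unfolding Eqp using quad[of 1 "-a" "-B"]
    by (simp add: pz algebra_simps power2_eq_square cong: Bochner_Integration.integral_cong)
  have sc: "(sin \<theta>)\<^sup>2 + (cos \<theta>)\<^sup>2 = 1" by simp
  have "expectation (\<lambda>\<omega>. (p \<omega> - g \<omega>)\<^sup>2) = (A - m)\<^sup>2 + (B - s)\<^sup>2"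
    using quad[of 0 "A - m" "B - s"]
    by (simp add: pz gz algebra_simps cong: Bochner_Integration.integral_cong)
  also have "\<dots> = e\<^sup>2 * ((sin \<theta>)\<^sup>2 + (cos \<theta>)\<^sup>2)"
    by (simp add: A_def B_def power_mult_distrib algebra_simps del: sin_cos_squared_add sin_cos_squared_add2)
  finally show "expectation (\<lambda>\<omega>. (p \<omega> - g \<omega>)\<^sup>2) = e\<^sup>2" by simp
  \<comment> \<open>The angle equation multiplied by \<open>cos \<theta>\<close>: the stationarity
    condition.\<close>
  have sin: "sin \<theta> = 2 * c * B * cos \<theta>"
    using \<theta> C by (simp add: B_def tan_def field_simps)
  \<comment> \<open>Since \<open>p - g\<close> has coordinates \<open>e * cos \<theta>\<close> and
    \<open>e * sin \<theta>\<close>, hence norm \<open>e\<close>, only twice the inner product of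
    \<open>q - p\<close> with \<open>p - g\<close> survives.\<close>
  have "b + m\<^sup>2 + s\<^sup>2 - 2 * m * a - 2 * s * k - e\<^sup>2 - (b + A\<^sup>2 + B\<^sup>2 - 2 * A * a - 2 * B * k)
      = 2 * e * cos \<theta> * (a - A) + 2 * e * sin \<theta> * (k - B)"
    using sc unfolding A_def B_def by algebra
  also have "\<dots> = (2 * e * cos \<theta>) * ((a - A) + 2 * c * B * (k - B))"
    by (subst sin) (simp add: algebra_simps)
  finally have "(expectation (\<lambda>\<omega>. (q \<omega> - g \<omega>)\<^sup>2) - e\<^sup>2 - expectation (\<lambda>\<omega>. (q \<omega> - p \<omega>)\<^sup>2))
      / (2 * e * cos \<theta>) = (a - A) + 2 * c * B * (k - B)"
    unfolding Dqg Dqp using C e by (simp add: field_simps)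
  \<comment> \<open>Here \<open>x\<close> and \<open>y\<close> stand for the squared distances of
    \<open>q\<close> from \<open>g\<close> and from \<open>p\<close>. The variance of
    \<open>q\<close> minus those of \<open>p\<close> and \<open>q - p\<close> is twice the
    covariance of \<open>p\<close> and \<open>q - p\<close>, namely \<open>2 * B * (k - B)\<close>,
    which is the term just found.\<close>
  moreover have "a + c * (b - a\<^sup>2) = A + c * B\<^sup>2 + (x - e\<^sup>2) / D
      + c * (b - a\<^sup>2 + B\<^sup>2 - 2 * B * k) - y / D"
    if "(x - e\<^sup>2 - y) / D = (a - A) + 2 * c * B * (k - B)" for x y D
    using that unfolding diff_divide_distrib by (simp add: algebra_simps power2_eq_square)
  ultimately show "expectation q + c * variance q = expectation p + c * variance p
      + (expectation (\<lambda>\<omega>. (q \<omega> - g \<omega>)\<^sup>2) - e\<^sup>2) / (2 * e * cos \<theta>)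
      + c * variance (\<lambda>\<omega>. q \<omega> - p \<omega>)
      - expectation (\<lambda>\<omega>. (q \<omega> - p \<omega>)\<^sup>2) / (2 * e * cos \<theta>)"
    unfolding Vp Vq Vqp unfolding Ep a_def[symmetric] by blast
qed

section \<open>The stationary angles\<close>

lemma worst_angle_ex1:
  fixes c1 c2 :: real
  assumes c1: "c1 > 0" and c2: "c2 > 0"
  shows "\<exists>!\<theta>. 0 < \<theta> \<and> \<theta> < pi/2 \<and> tan \<theta> - c1 - c2 * sin \<theta> = 0"
proof (rule ex_ex1I)
  \<comment> \<open>At this \<open>u\<close> the expression equals \<open>c2 * (1 - sin u)\<close>,
    which is nonnegative, and the tangent is continuous up to \<open>u\<close>.\<close>
  define u where "u = arctan (c1 + c2)"
  have u: "0 < u" "u < pi/2" "tan u = c1 + c2"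
    using c1 c2 by (auto simp: u_def arctan_ubound tan_arctan simp del: less_divide_eq_numeral1)
  have "\<exists>\<theta>. 0 \<le> \<theta> \<and> \<theta> \<le> u \<and> tan \<theta> - c1 - c2 * sin \<theta> = 0"
  proof (rule IVT')
    show "tan 0 - c1 - c2 * sin 0 \<le> 0" using c1 by simp
    show "0 \<le> tan u - c1 - c2 * sin u"
      using c2 mult_left_mono[OF sin_le_one[of u], of c2] by (simp add: u)
    show "0 \<le> u" using u by simp
    have "cos x \<noteq> 0" if "x \<in> {0..u}" for x
      using that u cos_gt_zero_pi[of x] by auto
    then show "continuous_on {0..u} (\<lambda>\<theta>. tan \<theta> - c1 - c2 * sin \<theta>)"
      by (intro continuous_intros) auto
  qed
  then obtain \<theta> where \<theta>: "0 \<le> \<theta>" "\<theta> \<le> u" "tan \<theta> - c1 - c2 * sin \<theta> = 0" by blast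
  then have "\<theta> \<noteq> 0" using c1 by auto
  with \<theta> u show "\<exists>\<theta>. 0 < \<theta> \<and> \<theta> < pi/2 \<and> tan \<theta> - c1 - c2 * sin \<theta> = 0"
    by (intro exI[of _ \<theta>]) auto
next
  \<comment> \<open>Dividing by \<open>sin \<theta>\<close> turns the equation into \<open>1 / cos \<theta> - c1 / sin \<theta> = c2\<close>,
    whose left-hand side increases.\<close>
  have no: False
    if "0 < \<theta>" "\<theta> < \<eta>" "\<eta> < pi/2" "tan \<theta> - c1 - c2 * sin \<theta> = 0" "tan \<eta> - c1 - c2 * sin \<eta> = 0"
    for \<theta> \<eta>
  proof -
    have pos: "0 < cos \<theta>" "0 < cos \<eta>" "0 < sin \<theta>" "0 < sin \<eta>"
      using that by (auto intro!: cos_gt_zero sin_gt_zero2)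
    have lt: "cos \<eta> < cos \<theta>" "sin \<theta> < sin \<eta>"
      using that by (auto intro!: cos_monotone_0_pi sin_monotone_2pi)
    have "c2 = 1 / cos \<theta> - c1 / sin \<theta>" "c2 = 1 / cos \<eta> - c1 / sin \<eta>"
      using that pos by (auto simp: tan_def field_simps)
    moreover have "1 / cos \<theta> < 1 / cos \<eta>" "c1 / sin \<eta> < c1 / sin \<theta>"
      using lt pos c1 by (auto intro!: divide_strict_left_mono)
    ultimately show False by linarith
  qed
  fix \<theta> \<eta>
  assume "0 < \<theta> \<and> \<theta> < pi/2 \<and> tan \<theta> - c1 - c2 * sin \<theta> = 0"
    "0 < \<eta> \<and> \<eta> < pi/2 \<and> tan \<eta> - c1 - c2 * sin \<eta> = 0"
  then show "\<theta> = \<eta>"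
    using no[of \<theta> \<eta>] no[of \<eta> \<theta>] by (cases \<theta> \<eta> rule: linorder_cases) auto
qed

text \<open>A shift by \<open>pi\<close> preserves the tangent and flips the sine, so with
  \<open>\<phi> = \<theta> - pi\<close> the equation becomes
  \<open>tan \<phi> - c1 + c2 * sin \<phi> = 0\<close> on \<open>(0, pi/2)\<close>, whose left-hand
  side is strictly increasing.\<close>

lemma best_angle_ex1:
  fixes c1 c2 :: real
  assumes c1: "c1 > 0" and c2: "c2 > 0"
  shows "\<exists>!\<theta>. pi < \<theta> \<and> \<theta> < 3*pi/2 \<and> tan \<theta> - c1 - c2 * sin \<theta> = 0"
proof (rule ex_ex1I)
  \<comment> \<open>Here the shifted expression equals \<open>c2 * sin u\<close>, which is
    positive.\<close>
  define u where "u = arctan c1"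
  have u: "0 < u" "u < pi/2" "tan u = c1"
    using c1 by (auto simp: u_def arctan_ubound tan_arctan simp del: less_divide_eq_numeral1)
  have "\<exists>\<phi>. 0 \<le> \<phi> \<and> \<phi> \<le> u \<and> tan \<phi> - c1 + c2 * sin \<phi> = 0"
  proof (rule IVT')
    show "tan 0 - c1 + c2 * sin 0 \<le> 0" using c1 by simp
    show "0 \<le> tan u - c1 + c2 * sin u"
      using c2 u sin_gt_zero2[of u] by simp
    show "0 \<le> u" using u by simp
    have "cos x \<noteq> 0" if "x \<in> {0..u}" for x
      using that u cos_gt_zero_pi[of x] by auto
    then show "continuous_on {0..u} (\<lambda>\<theta>. tan \<theta> - c1 + c2 * sin \<theta>)"
      by (intro continuous_intros) auto
  qed
  then obtain \<phi> where \<phi>: "0 \<le> \<phi>" "\<phi> \<le> u" "tan \<phi> - c1 + c2 * sin \<phi> = 0" by blast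
  then have "\<phi> \<noteq> 0" using c1 by auto
  with \<phi> u show "\<exists>\<theta>. pi < \<theta> \<and> \<theta> < 3*pi/2 \<and> tan \<theta> - c1 - c2 * sin \<theta> = 0"
    by (intro exI[of _ "\<phi> + pi"]) auto
next
  have no: False
    if "pi < \<theta>" "\<theta> < \<eta>" "\<eta> < 3*pi/2" "tan \<theta> - c1 - c2 * sin \<theta> = 0" "tan \<eta> - c1 - c2 * sin \<eta> = 0"
    for \<theta> \<eta>
  proof -
    have "- (pi/2) < \<theta> - pi" "\<theta> - pi < \<eta> - pi" "\<eta> - pi < pi/2"
      using that by linarith+
    then have "tan (\<theta> - pi) < tan (\<eta> - pi)" "sin (\<theta> - pi) < sin (\<eta> - pi)"
      by (blast intro: tan_monotone, blast intro: sin_monotone_2pi less_imp_le)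
    moreover have "tan (x - pi) = tan x" "sin (x - pi) = - sin x" for x :: real
      using tan_periodic_pi[of "x - pi"] by (auto simp: sin_diff)
    ultimately have "tan \<theta> < tan \<eta>" "sin \<eta> < sin \<theta>" by auto
    with that c2 show False
      using mult_strict_left_mono[of "sin \<eta>" "sin \<theta>" c2] by linarith
  qed
  fix \<theta> \<eta>
  assume "pi < \<theta> \<and> \<theta> < 3*pi/2 \<and> tan \<theta> - c1 - c2 * sin \<theta> = 0"
    "pi < \<eta> \<and> \<eta> < 3*pi/2 \<and> tan \<eta> - c1 - c2 * sin \<eta> = 0"
  then show "\<theta> = \<eta>"
    using no[of \<theta> \<eta>] no[of \<eta> \<theta>] by (cases \<theta> \<eta> rule: linorder_cases) auto
qed

section \<open>Quantile functions as random variables\<close>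

text \<open>The space on which quantile functions live as random variables; the open interval leaves
  out the endpoints, where \<open>quantile\<close> is not meaningful.\<close>

abbreviation unit_uniform :: "real measure" where
  "unit_uniform \<equiv> restrict_space lborel {0<..<1}"

interpretation unit_uniform: prob_space unit_uniform
  by (auto simp: space_restrict_space emeasure_restrict_space intro!: prob_spaceI)

context
  fixes F :: "real \<Rightarrow> real"
  assumes F: "is_cdf F"
begin

lemma cdf_interval_measure_is_cdf: "cdf (interval_measure F) = F"
  using F by (intro cdf_interval_measure) (auto simp: is_cdf_def mono_def)

lemma real_distribution_is_cdf: "real_distribution (interval_measure F)"
  using F by (intro real_distribution_interval_measure) (auto simp: is_cdf_def mono_def)

lemma cdf_distribution_is_cdf: "cdf_distribution (interval_measure F)"
  using real_distribution_is_cdf by (simp add: cdf_distribution_def)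

text \<open>A Galois connection, resting on right continuity, by which the infimum is
  attained.\<close>

lemma quantile_le_iff: "0 < t \<Longrightarrow> t < 1 \<Longrightarrow> quantile F t \<le> x \<longleftrightarrow> t \<le> F x"
  using right_continuous_mono.pseudoinverse[of F 0 1 t x] F
  by (auto simp: right_continuous_mono_def is_cdf_def quantile_def)

text \<open>The inverse transform; it turns moments of \<open>F\<close> into integrals of
  \<open>quantile F\<close> over the unit interval.\<close>

lemma distr_quantile: "distr unit_uniform borel (quantile F) = interval_measure F"
  using cdf_distribution.distr_I_eq_M[OF cdf_distribution_is_cdf]
  by (simp add: cdf_interval_measure_is_cdf quantile_def[abs_def])

lemma measurable_quantile: "quantile F \<in> borel_measurable unit_uniform"
  using cdf_distribution.measurable_CI[OF cdf_distribution_is_cdf]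
  by (simp add: cdf_interval_measure_is_cdf quantile_def[abs_def] cong: measurable_cong_sets)

lemma quantile_L2_iff: "quantile F \<in> L2 unit_uniform \<longleftrightarrow> cdf_finite_second_moment F"
  by (simp add: L2_distr_iff measurable_quantile distr_quantile cdf_finite_second_moment_def)

lemma cdf_mean_quantile: "cdf_mean F = unit_uniform.expectation (quantile F)"
  unfolding cdf_mean_def distr_quantile[symmetric]
  by (subst integral_distr) (simp_all add: measurable_quantile)

lemma cdf_sd_quantile: "cdf_sd F = sqrt (unit_uniform.variance (quantile F))"
  unfolding cdf_sd_def cdf_mean_quantile distr_quantile[symmetric]
  by (subst integral_distr) (simp_all add: measurable_quantile)

text \<open>The extremal distributions are location-scale transforms of \<open>G\<close>. The
  rescaled function is the distribution function of an image law, so it inherits the defining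
  properties.\<close>

lemma
  assumes b: "b > 0"
  shows is_cdf_affine: "is_cdf (\<lambda>x. F ((x - a) / b))"
    and quantile_affine:
      "0 < t \<Longrightarrow> t < 1 \<Longrightarrow> quantile (\<lambda>x. F ((x - a) / b)) t = a + b * quantile F t"
proof -
  let ?D = "distr (interval_measure F) borel (\<lambda>x. a + b * x)"
  interpret D: real_distribution ?D
    using real_distribution_is_cdf
    by (intro prob_space.real_distribution_distr) (auto simp: real_distribution_def)
  have "cdf ?D x = cdf (interval_measure F) ((x - a) / b)" for x
  proof -
    have "(\<lambda>y. a + b * y) -` {..x} = {..(x - a) / b}"
      using b by (auto simp: field_simps)
    then show ?thesis
      by (simp add: cdf_def measure_distr)
  qed
  then have "cdf ?D = (\<lambda>x. F ((x - a) / b))"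
    by (auto simp: cdf_interval_measure_is_cdf)
  then show cdf: "is_cdf (\<lambda>x. F ((x - a) / b))"
    unfolding is_cdf_def
    using D.cdf_is_right_cont D.cdf_lim_at_bot D.cdf_lim_at_top_prob D.cdf_nondecreasing
    by (auto simp: mono_def)
  \<comment> \<open>By the Galois connection the set under the infimum is a closed
    half-line.\<close>
  have "{x. t \<le> F ((x - a) / b)} = {a + b * quantile F t..}" if "0 < t" "t < 1"
    using b by (auto simp: quantile_le_iff[OF that, symmetric] field_simps)
  then show "0 < t \<Longrightarrow> t < 1 \<Longrightarrow> quantile (\<lambda>x. F ((x - a) / b)) t = a + b * quantile F t"
    by (simp add: quantile_def)
qed

end

text \<open>The law is the image of the uniform measure under the quantile function, so null sets of
  \<open>t\<close> do not matter.\<close>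

lemma is_cdf_eqI:
  assumes F: "is_cdf F" and G: "is_cdf G"
    and "AE t in unit_uniform. quantile F t = quantile G t"
  shows "F = G"
proof -
  have "interval_measure F = interval_measure G"
    unfolding distr_quantile[OF F, symmetric] distr_quantile[OF G, symmetric]
    using assms by (intro distr_cong_AE) (auto simp: measurable_quantile)
  then show ?thesis
    using cdf_interval_measure_is_cdf F G by metis
qed

lemma W2_unit_uniform:
  "W2 F G = sqrt (unit_uniform.expectation (\<lambda>t. (quantile F t - quantile G t)\<^sup>2))"
  unfolding W2_def set_lebesgue_integral_def by (subst integral_restrict_space) auto

lemma (in prob_space) mean_variance_eq_quantile:
  assumes X: "X \<in> borel_measurable M" and F: "is_cdf F" and eq: "cdf (distr M borel X) = F"
  shows "mean_variance M c X = mean_variance unit_uniform c (quantile F)"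
    and "X \<in> L2 M \<longleftrightarrow> cdf_finite_second_moment F"
proof -
  have D: "distr M borel X = interval_measure F"
    using X F eq by (intro cdf_unique real_distribution_distr real_distribution_is_cdf)
      (auto simp: cdf_interval_measure_is_cdf)
  then show "mean_variance M c X = mean_variance unit_uniform c (quantile F)"
    using X F by (intro mean_variance_distr_cong) (auto simp: measurable_quantile distr_quantile)
  show "X \<in> L2 M \<longleftrightarrow> cdf_finite_second_moment F"
    using X D by (simp add: L2_distr_iff cdf_finite_second_moment_def)
qed

section \<open>Extremal distributions in the Wasserstein ball\<close>

lemma wasserstein_ballD:
  assumes "F \<in> wasserstein_ball G \<epsilon>"
  shows "is_cdf F" "cdf_finite_second_moment F" "quantile F \<in> L2 unit_uniform"
    and "unit_uniform.expectation (\<lambda>t. (quantile F t - quantile G t)\<^sup>2) \<le> \<epsilon>"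
  using assms by (auto simp: wasserstein_ball_def quantile_L2_iff W2_unit_uniform)

text \<open>The source of strictness, and hence of the uniqueness of the extremal distributions:
  distance zero would make the quantile functions agree almost everywhere.\<close>

lemma is_cdf_neq_imp_distance_pos:
  assumes F: "is_cdf F" "cdf_finite_second_moment F"
    and G: "is_cdf G" "cdf_finite_second_moment G" and ne: "F \<noteq> G"
  shows "0 < unit_uniform.expectation (\<lambda>t. (quantile F t - quantile G t)\<^sup>2)"
proof -
  have "(\<lambda>t. quantile F t - quantile G t) \<in> L2 unit_uniform"
    using F G by (intro unit_uniform.L2_diff) (auto simp: quantile_L2_iff)
  then have int: "integrable unit_uniform (\<lambda>t. (quantile F t - quantile G t)\<^sup>2)"
    by (rule unit_uniform.L2_square_integrable)
  have "unit_uniform.expectation (\<lambda>t. (quantile F t - quantile G t)\<^sup>2) \<noteq> 0"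
    using ne is_cdf_eqI[OF F(1) G(1)] integral_nonneg_eq_0_iff_AE[OF int] by auto
  moreover have "0 \<le> unit_uniform.expectation (\<lambda>t. (quantile F t - quantile G t)\<^sup>2)"
    by (intro integral_nonneg_AE) auto
  ultimately show ?thesis by linarith
qed

text \<open>One construction serves both angles; the sign of \<open>cos \<theta>\<close> decides
  between maximum and minimum. The assumption \<open>pos\<close> makes the affine map increasing, so
  that it carries the quantile function of \<open>G\<close> to another quantile function.\<close>

lemma wasserstein_ball_extremal:
  assumes G: "is_cdf G" "cdf_finite_second_moment G"
    and m: "m = cdf_mean G" and s: "s = cdf_sd G" "s > 0" and e: "\<epsilon> > 0" and c: "c > 0"
    and C: "cos \<theta> \<noteq> 0"
    and \<theta>: "tan \<theta> - 2 * c * s - 2 * c * sqrt \<epsilon> * sin \<theta> = 0"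
    and pos: "s + sqrt \<epsilon> * sin \<theta> > 0"
  obtains F\<^sub>0 where "F\<^sub>0 \<in> wasserstein_ball G \<epsilon>"
    and "\<And>t. 0 < t \<Longrightarrow> t < 1 \<Longrightarrow> quantile F\<^sub>0 t
      = (m + sqrt \<epsilon> * cos \<theta>) + (s + sqrt \<epsilon> * sin \<theta>) * ((quantile G t - m) / s)"
    and "\<And>F. F \<in> wasserstein_ball G \<epsilon> \<Longrightarrow> F \<noteq> F\<^sub>0 \<Longrightarrow> 0 < cos \<theta> \<Longrightarrow> 2 * c * sqrt \<epsilon> * cos \<theta> < 1 \<Longrightarrow>
      mean_variance unit_uniform c (quantile F) < mean_variance unit_uniform c (quantile F\<^sub>0)"
    and "\<And>F. F \<in> wasserstein_ball G \<epsilon> \<Longrightarrow> F \<noteq> F\<^sub>0 \<Longrightarrow> cos \<theta> < 0 \<Longrightarrow>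
      mean_variance unit_uniform c (quantile F\<^sub>0) < mean_variance unit_uniform c (quantile F)"
proof -
  \<comment> \<open>Slope \<open>b\<close> and intercept \<open>a\<close> of the desired quantile
    function as an affine function of \<open>quantile G t\<close>.\<close>
  define b where "b = (s + sqrt \<epsilon> * sin \<theta>) / s"
  define a where "a = (m + sqrt \<epsilon> * cos \<theta>) - b * m"
  define F\<^sub>0 where "F\<^sub>0 = (\<lambda>x. G ((x - a) / b))"
  have b: "b > 0"
    using pos s by (simp add: b_def)
  have F0: "is_cdf F\<^sub>0"
    unfolding F\<^sub>0_def by (rule is_cdf_affine[OF G(1) b])
  have q0': "quantile F\<^sub>0 t = a + b * quantile G t" if "0 < t" "t < 1" for t
    unfolding F\<^sub>0_def by (rule quantile_affine[OF G(1) b that])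
  then have q0: "quantile F\<^sub>0 t
      = (m + sqrt \<epsilon> * cos \<theta>) + (s + sqrt \<epsilon> * sin \<theta>) * ((quantile G t - m) / s)"
    if "0 < t" "t < 1" for t
    using that by (simp add: a_def b_def diff_divide_distrib right_diff_distrib)
  have g: "quantile G \<in> L2 unit_uniform"
    using G by (simp add: quantile_L2_iff)
  have "(\<lambda>t. a + b * quantile G t) \<in> L2 unit_uniform"
    by (intro unit_uniform.L2_add unit_uniform.L2_const unit_uniform.L2_mult g)
  then have p: "quantile F\<^sub>0 \<in> L2 unit_uniform"
    by (subst unit_uniform.L2_cong[where Z = "\<lambda>t. a + b * quantile G t"])
       (auto simp: q0' space_restrict_space)
  then have F0': "cdf_finite_second_moment F\<^sub>0"
    using F0 by (simp add: quantile_L2_iff)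
  have m': "m = unit_uniform.expectation (quantile G)"
    using G by (simp add: m cdf_mean_quantile)
  have s': "s\<^sup>2 = unit_uniform.variance (quantile G)"
    using G by (simp add: s cdf_sd_quantile unit_uniform.variance_positive)
  have e': "sqrt \<epsilon> > 0" using e by simp
  note expansion = unit_uniform.mean_variance_expansion[OF _ g m' s' s(2) e' C \<theta>,
      where p = "quantile F\<^sub>0"]
  have "unit_uniform.expectation (\<lambda>t. (quantile F\<^sub>0 t - quantile G t)\<^sup>2) = (sqrt \<epsilon>)\<^sup>2"
    \<comment> \<open>This part of the expansion does not mention \<open>q\<close>, so
      \<open>quantile G\<close> fills its place. The candidate lies on the boundary of the
      ball.\<close>
    by (rule expansion(1)[OF g]) (simp add: q0 space_restrict_space)
  then have ball: "F\<^sub>0 \<in> wasserstein_ball G \<epsilon>"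
    using F0 F0' e by (simp add: wasserstein_ball_def W2_unit_uniform)
  show ?thesis
  proof (rule that)
    show "F\<^sub>0 \<in> wasserstein_ball G \<epsilon>" by (rule ball)
    show "quantile F\<^sub>0 t
      = (m + sqrt \<epsilon> * cos \<theta>) + (s + sqrt \<epsilon> * sin \<theta>) * ((quantile G t - m) / s)"
      if "0 < t" "t < 1" for t
      using that by (rule q0)
  next
    fix F assume F: "F \<in> wasserstein_ball G \<epsilon>" "F \<noteq> F\<^sub>0"
    note FD = wasserstein_ballD[OF F(1)]
    define J where "J f = unit_uniform.expectation (quantile f)
      + c * unit_uniform.variance (quantile f)" for f
    define R where "R = unit_uniform.expectation (\<lambda>t. (quantile F t - quantile G t)\<^sup>2) - (sqrt \<epsilon>)\<^sup>2"
    define D where "D = unit_uniform.expectation (\<lambda>t. (quantile F t - quantile F\<^sub>0 t)\<^sup>2)"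
    define V where "V = unit_uniform.variance (\<lambda>t. quantile F t - quantile F\<^sub>0 t)"
    have mv: "mean_variance unit_uniform c (quantile F) = ereal (J F)"
      "mean_variance unit_uniform c (quantile F\<^sub>0) = ereal (J F\<^sub>0)"
      using FD p by (auto simp: unit_uniform.mean_variance_L2 J_def)
    have J: "J F = J F\<^sub>0 + R / (2 * sqrt \<epsilon> * cos \<theta>) + c * V - D / (2 * sqrt \<epsilon> * cos \<theta>)"
      unfolding J_def R_def D_def V_def
      by (rule expansion(2)[OF FD(3)]) (simp add: q0 space_restrict_space)
    have R: "R \<le> 0"
      using FD(4) e by (simp add: R_def)
    have D: "D > 0"
      unfolding D_def by (rule is_cdf_neq_imp_distance_pos[OF FD(1,2) F0 F0' F(2)])
    have h: "(\<lambda>t. quantile F t - quantile F\<^sub>0 t) \<in> L2 unit_uniform"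
      by (rule unit_uniform.L2_diff[OF FD(3) p])
    have V: "0 \<le> V"
      unfolding V_def by (rule unit_uniform.variance_positive)
    have VD: "V \<le> D"
      unfolding V_def D_def unit_uniform.variance_eq[OF unit_uniform.L2_integrable[OF h]
          unit_uniform.L2_square_integrable[OF h]] by simp
    show "mean_variance unit_uniform c (quantile F) < mean_variance unit_uniform c (quantile F\<^sub>0)"
      if K: "0 < cos \<theta>" "2 * c * sqrt \<epsilon> * cos \<theta> < 1"
    proof -
      have K': "2 * sqrt \<epsilon> * cos \<theta> > 0" using K e by simp
      \<comment> \<open>With the multiplier above \<open>c\<close>, the loss from \<open>D\<close>
        outweighs the gain \<open>c * V\<close>, since \<open>V \<le> D\<close>; the term with
        \<open>R\<close> is at most zero.\<close>
      have "c < 1 / (2 * sqrt \<epsilon> * cos \<theta>)"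
        using K(2) K' by (simp add: pos_less_divide_eq algebra_simps)
      then have "c * D < D / (2 * sqrt \<epsilon> * cos \<theta>)"
        using mult_strict_right_mono[OF _ D] by fastforce
      moreover have "c * V \<le> c * D" using VD c by simp
      moreover have "R / (2 * sqrt \<epsilon> * cos \<theta>) \<le> 0"
        using R K' by (simp add: divide_nonpos_pos)
      ultimately show ?thesis unfolding mv using J by simp
    qed
    show "mean_variance unit_uniform c (quantile F\<^sub>0) < mean_variance unit_uniform c (quantile F)"
      if K: "cos \<theta> < 0"
    proof -
      \<comment> \<open>The negative divisor makes all three corrections to
        \<open>J F\<^sub>0\<close> nonnegative, and the one with \<open>D\<close> positive.\<close>
      have K': "2 * sqrt \<epsilon> * cos \<theta> < 0" using K e by (simp add: mult_pos_neg)
      have "D / (2 * sqrt \<epsilon> * cos \<theta>) < 0" "0 \<le> R / (2 * sqrt \<epsilon> * cos \<theta>)"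
        using R D K' by (auto intro: divide_pos_neg divide_nonpos_neg)
      moreover have "0 \<le> c * V" using V c by simp
      ultimately show ?thesis unfolding mv using J by simp
    qed
  qed
qed

lemma wasserstein_ball_worst_case:
  assumes G: "is_cdf G" "cdf_finite_second_moment G"
    and m: "m = cdf_mean G" and s: "s = cdf_sd G" "s > 0" and e: "\<epsilon> > 0" and c: "c > 0"
    and \<theta>: "0 < \<theta>" "\<theta> < pi/2" "tan \<theta> - 2 * c * s - 2 * c * sqrt \<epsilon> * sin \<theta> = 0"
  obtains F\<^sub>0 where "F\<^sub>0 \<in> wasserstein_ball G \<epsilon>"
    and "\<And>t. 0 < t \<Longrightarrow> t < 1 \<Longrightarrow> quantile F\<^sub>0 t
      = (m + sqrt \<epsilon> * cos \<theta>) + (s + sqrt \<epsilon> * sin \<theta>) * ((quantile G t - m) / s)"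
    and "\<And>F. F \<in> wasserstein_ball G \<epsilon> \<Longrightarrow> F \<noteq> F\<^sub>0 \<Longrightarrow>
      mean_variance unit_uniform c (quantile F) < mean_variance unit_uniform c (quantile F\<^sub>0)"
proof -
  have sc: "sin \<theta> > 0" "cos \<theta> > 0"
    using \<theta> by (auto intro: sin_gt_zero2 cos_gt_zero)
  have pos: "s + sqrt \<epsilon> * sin \<theta> > 0"
    using s e sc by (simp add: add_pos_pos)
  \<comment> \<open>The angle equation times \<open>cos \<theta>\<close>; dropping its positive
    first summand and cancelling \<open>sin \<theta>\<close> bounds the multiplier.\<close>
  have "sin \<theta> = 2 * c * s * cos \<theta> + sin \<theta> * (2 * c * sqrt \<epsilon> * cos \<theta>)"
    using \<theta>(3) sc by (simp add: tan_def field_simps)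
  moreover have "0 < 2 * c * s * cos \<theta>"
    using c s sc by simp
  ultimately have "sin \<theta> * (2 * c * sqrt \<epsilon> * cos \<theta>) < sin \<theta> * 1"
    by linarith
  then have K: "2 * c * sqrt \<epsilon> * cos \<theta> < 1"
    using sc by (subst (asm) mult_less_cancel_left_pos)
  have "cos \<theta> \<noteq> 0" using sc by simp
  then show ?thesis
  proof (rule wasserstein_ball_extremal[OF G m s e c _ \<theta>(3) pos], goal_cases)
    case (1 F\<^sub>0)
    show ?thesis
      by (rule that[OF 1(1,2)]) (use 1(3) sc K in auto)
  qed
qed

lemma wasserstein_ball_best_case:
  assumes G: "is_cdf G" "cdf_finite_second_moment G"
    and m: "m = cdf_mean G" and s: "s = cdf_sd G" "s > 0" and e: "\<epsilon> > 0" and c: "c > 0"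
    and \<theta>: "pi < \<theta>" "\<theta> < 3*pi/2" "tan \<theta> - 2 * c * s - 2 * c * sqrt \<epsilon> * sin \<theta> = 0"
  obtains F\<^sub>0 where "F\<^sub>0 \<in> wasserstein_ball G \<epsilon>"
    and "\<And>t. 0 < t \<Longrightarrow> t < 1 \<Longrightarrow> quantile F\<^sub>0 t
      = (m + sqrt \<epsilon> * cos \<theta>) + (s + sqrt \<epsilon> * sin \<theta>) * ((quantile G t - m) / s)"
    and "\<And>F. F \<in> wasserstein_ball G \<epsilon> \<Longrightarrow> F \<noteq> F\<^sub>0 \<Longrightarrow>
      mean_variance unit_uniform c (quantile F\<^sub>0) < mean_variance unit_uniform c (quantile F)"
proof -
  have "0 < sin (\<theta> - pi)" "0 < cos (\<theta> - pi)"
    using \<theta> by (intro sin_gt_zero2 cos_gt_zero; simp)+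
  then have sc: "sin \<theta> < 0" "cos \<theta> < 0"
    by (auto simp: sin_diff cos_diff)
  \<comment> \<open>As \<open>sin \<theta>\<close> is negative, positivity of the slope is not
    evident; the angle equation makes it \<open>tan \<theta> / (2 * c)\<close>.\<close>
  have "0 < tan \<theta>"
    using sc by (simp add: tan_def divide_neg_neg)
  also have "tan \<theta> = 2 * c * (s + sqrt \<epsilon> * sin \<theta>)"
    using \<theta>(3) by (simp add: algebra_simps)
  finally have pos: "s + sqrt \<epsilon> * sin \<theta> > 0"
    using c by (simp add: zero_less_mult_iff)
  have "cos \<theta> \<noteq> 0" using sc by simp
  then show ?thesis
  proof (rule wasserstein_ball_extremal[OF G m s e c _ \<theta>(3) pos], goal_cases)
    case (1 F\<^sub>0)
    show ?thesis
      by (rule that[OF 1(1,2)]) (use 1(4) sc in auto)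
  qed
qed

section \<open>Unique extremisers and monotonicity of the objective\<close>

lemma SUP_argmax:
  fixes f :: "'a \<Rightarrow> 'b::complete_linorder"
  assumes x: "x \<in> A" and less: "\<And>y. y \<in> A \<Longrightarrow> y \<noteq> x \<Longrightarrow> f y < f x"
  shows "{y \<in> A. f y = (SUP z\<in>A. f z)} = {x}"
proof -
  have "f y \<le> f x" if "y \<in> A" for y
    using less[OF that] by (cases "y = x") auto
  then have "(SUP z\<in>A. f z) = f x"
    using x by (intro SUP_eqI) auto
  then show ?thesis
    using x less by auto (metis less_irrefl)
qed

lemma INF_argmin:
  fixes f :: "'a \<Rightarrow> 'b::complete_linorder"
  assumes x: "x \<in> A" and less: "\<And>y. y \<in> A \<Longrightarrow> y \<noteq> x \<Longrightarrow> f x < f y"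
  shows "{y \<in> A. f y = (INF z\<in>A. f z)} = {x}"
proof -
  have "f x \<le> f y" if "y \<in> A" for y
    using less[OF that] by (cases "y = x") auto
  then have "(INF z\<in>A. f z) = f x"
    using x by (intro INF_eqI) auto
  then show ?thesis
    using x less by auto (metis less_irrefl)
qed

lemma alpha_maxmin_mono:
  assumes "0 \<le> \<alpha>" "\<alpha> \<le> 1"
    and "\<And>F. F \<in> \<M> \<Longrightarrow> total_evaluation Q n \<gamma> Y F \<le> total_evaluation Q n \<gamma> Z F"
  shows "alpha_maxmin Q \<M> \<alpha> n \<gamma> Y \<le> alpha_maxmin Q \<M> \<alpha> n \<gamma> Z"
  unfolding alpha_maxmin_def using assms
  by (intro add_mono ereal_mult_left_mono SUP_mono INF_mono) auto

theorem theorem4p1: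
  fixes P :: "'w measure" and X :: "'w \<Rightarrow> real" and Q :: "(real \<Rightarrow> real) \<Rightarrow> 'w measure"
    and n :: nat and \<gamma> :: "nat \<Rightarrow> real" and \<alpha> \<epsilon> \<mu>G \<sigma>G \<gamma>bar :: real
    and G :: "real \<Rightarrow> real"
  assumes "prob_space P" and "atomless P" and "X \<in> L2 P"
    and "n \<ge> 1" and "\<And>i. i \<in> {1..n} \<Longrightarrow> \<gamma> i > 0"
    and "0 \<le> \<alpha>" and "\<alpha> \<le> 1" and "\<epsilon> > 0"
    and "is_cdf G" and "cdf_finite_second_moment G"
    and "\<mu>G = cdf_mean G" and "\<sigma>G = cdf_sd G" and "\<sigma>G > 0"
    and "\<And>F. F \<in> wasserstein_ball G \<epsilon> \<Longrightarrow>
           prob_space (Q F) \<and> sets (Q F) = sets P \<and> cdf (distr (Q F) borel X) = F"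
    and "\<gamma>bar = inverse (\<Sum>i=1..n. 1 / \<gamma> i)"
  shows "\<exists>\<theta>w \<theta>b Fwo Fbe.
      {\<theta>. 0 < \<theta> \<and> \<theta> < pi/2 \<and> tan \<theta> - 2 * \<gamma>bar * \<sigma>G - 2 * \<gamma>bar * sqrt \<epsilon> * sin \<theta> = 0} = {\<theta>w} \<and>
      {\<theta>. pi < \<theta> \<and> \<theta> < 3*pi/2 \<and> tan \<theta> - 2 * \<gamma>bar * \<sigma>G - 2 * \<gamma>bar * sqrt \<epsilon> * sin \<theta> = 0} = {\<theta>b} \<and>
      (\<forall>t. 0 < t \<and> t < 1 \<longrightarrow>
         quantile Fwo t = (\<mu>G + sqrt \<epsilon> * cos \<theta>w)
           + (\<sigma>G + sqrt \<epsilon> * sin \<theta>w) * ((quantile G t - \<mu>G) / \<sigma>G)) \<and>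
      (\<forall>t. 0 < t \<and> t < 1 \<longrightarrow>
         quantile Fbe t = (\<mu>G + sqrt \<epsilon> * cos \<theta>b)
           + (\<sigma>G + sqrt \<epsilon> * sin \<theta>b) * ((quantile G t - \<mu>G) / \<sigma>G)) \<and>
      (\<forall>\<beta> :: nat \<Rightarrow> real. (\<Sum>i=1..n. \<beta> i) = 0 \<longrightarrow>
         (let Xopt = (\<lambda>i \<omega>. (1 / \<gamma> i) / (\<Sum>j=1..n. 1 / \<gamma> j) * X \<omega> + \<beta> i);
              \<M> = wasserstein_ball G \<epsilon>
          in Xopt \<in> allocations P n X \<and>
             alpha_maxmin Q \<M> \<alpha> n \<gamma> Xopt
               = (INF Y\<in>allocations P n X. alpha_maxmin Q \<M> \<alpha> n \<gamma> Y) \<and>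
             {F \<in> \<M>. total_evaluation Q n \<gamma> Xopt F
                      = (SUP F\<in>\<M>. total_evaluation Q n \<gamma> Xopt F)} = {Fwo} \<and>
             {F \<in> \<M>. total_evaluation Q n \<gamma> Xopt F
                      = (INF F\<in>\<M>. total_evaluation Q n \<gamma> Xopt F)} = {Fbe}))"
proof -
  let ?\<M> = "wasserstein_ball G \<epsilon>"
  interpret P: prob_space P by fact
  note G = assms(9,10) and mG = assms(11) and sG = assms(12,13) and Q = assms(14)
  have \<gamma>: "\<gamma> i > 0" if "i \<in> {1..n}" for i using that by (rule assms(5))
  have ne: "{1..n} \<noteq> {}" using \<open>n \<ge> 1\<close> by simp
  have S: "(\<Sum>i=1..n. 1 / \<gamma> i) > 0"
    using \<gamma> ne by (intro sum_pos) auto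
  then have c: "\<gamma>bar > 0" by (simp add: assms(15))
  have c1: "2 * \<gamma>bar * \<sigma>G > 0" and c2: "2 * \<gamma>bar * sqrt \<epsilon> > 0"
    using c \<open>\<sigma>G > 0\<close> \<open>\<epsilon> > 0\<close> by auto
  obtain \<theta>w where
    w: "{\<theta>. 0 < \<theta> \<and> \<theta> < pi/2 \<and> tan \<theta> - 2 * \<gamma>bar * \<sigma>G - 2 * \<gamma>bar * sqrt \<epsilon> * sin \<theta> = 0} = {\<theta>w}"
    using worst_angle_ex1[OF c1 c2] by (auto elim!: ex1E)
  obtain \<theta>b where
    b: "{\<theta>. pi < \<theta> \<and> \<theta> < 3*pi/2 \<and> tan \<theta> - 2 * \<gamma>bar * \<sigma>G - 2 * \<gamma>bar * sqrt \<epsilon> * sin \<theta> = 0} = {\<theta>b}"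
    using best_angle_ex1[OF c1 c2] by (auto elim!: ex1E)
  have w': "0 < \<theta>w" "\<theta>w < pi/2" "tan \<theta>w - 2 * \<gamma>bar * \<sigma>G - 2 * \<gamma>bar * sqrt \<epsilon> * sin \<theta>w = 0"
    using w by blast+
  have b': "pi < \<theta>b" "\<theta>b < 3*pi/2" "tan \<theta>b - 2 * \<gamma>bar * \<sigma>G - 2 * \<gamma>bar * sqrt \<epsilon> * sin \<theta>b = 0"
    using b by blast+
  obtain Fwo where Fwo: "Fwo \<in> ?\<M>"
    "\<And>t. 0 < t \<Longrightarrow> t < 1 \<Longrightarrow> quantile Fwo t
      = (\<mu>G + sqrt \<epsilon> * cos \<theta>w) + (\<sigma>G + sqrt \<epsilon> * sin \<theta>w) * ((quantile G t - \<mu>G) / \<sigma>G)"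
    "\<And>F. F \<in> ?\<M> \<Longrightarrow> F \<noteq> Fwo \<Longrightarrow>
      mean_variance unit_uniform \<gamma>bar (quantile F) < mean_variance unit_uniform \<gamma>bar (quantile Fwo)"
    using wasserstein_ball_worst_case[OF G mG sG \<open>\<epsilon> > 0\<close> c w'] by blast
  obtain Fbe where Fbe: "Fbe \<in> ?\<M>"
    "\<And>t. 0 < t \<Longrightarrow> t < 1 \<Longrightarrow> quantile Fbe t
      = (\<mu>G + sqrt \<epsilon> * cos \<theta>b) + (\<sigma>G + sqrt \<epsilon> * sin \<theta>b) * ((quantile G t - \<mu>G) / \<sigma>G)"
    "\<And>F. F \<in> ?\<M> \<Longrightarrow> F \<noteq> Fbe \<Longrightarrow>
      mean_variance unit_uniform \<gamma>bar (quantile Fbe) < mean_variance unit_uniform \<gamma>bar (quantile F)"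
    using wasserstein_ball_best_case[OF G mG sG \<open>\<epsilon> > 0\<close> c b'] by blast
  \<comment> \<open>Square integrability under \<open>Q F\<close> comes from the second moment of
    \<open>F\<close>, not from \<open>X \<in> L2 P\<close>. Equal sigma-algebras give equal spaces,
    so the allocation constraint carries over.\<close>
  have QX: "X \<in> L2 (Q F)" "prob_space (Q F)" "space (Q F) = space P"
    "mean_variance (Q F) c X = mean_variance unit_uniform c (quantile F)"
    if F: "F \<in> ?\<M>" for F c
  proof -
    show ps: "prob_space (Q F)" using Q[OF F] by blast
    show "space (Q F) = space P" using Q[OF F] sets_eq_imp_space_eq by blast
    have X: "X \<in> borel_measurable (Q F)"
      using Q[OF F] P.L2_measurable[OF \<open>X \<in> L2 P\<close>] measurable_cong_sets by blast
    show "X \<in> L2 (Q F)"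
      using prob_space.mean_variance_eq_quantile(2)[OF ps X] wasserstein_ballD[OF F] Q[OF F] by blast
    show "mean_variance (Q F) c X = mean_variance unit_uniform c (quantile F)"
      using prob_space.mean_variance_eq_quantile(1)[OF ps X] wasserstein_ballD[OF F] Q[OF F] by blast
  qed
  define Xopt where
    "Xopt \<beta> = (\<lambda>i \<omega>. (1 / \<gamma> i) / (\<Sum>j=1..n. 1 / \<gamma> j) * X \<omega> + \<beta> i)" for \<beta> :: "nat \<Rightarrow> real"
  have main: "Xopt \<beta> \<in> allocations P n X"
    "alpha_maxmin Q ?\<M> \<alpha> n \<gamma> (Xopt \<beta>) = (INF Y\<in>allocations P n X. alpha_maxmin Q ?\<M> \<alpha> n \<gamma> Y)"
    "{F \<in> ?\<M>. total_evaluation Q n \<gamma> (Xopt \<beta>) F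
        = (SUP F\<in>?\<M>. total_evaluation Q n \<gamma> (Xopt \<beta>) F)} = {Fwo}"
    "{F \<in> ?\<M>. total_evaluation Q n \<gamma> (Xopt \<beta>) F
        = (INF F\<in>?\<M>. total_evaluation Q n \<gamma> (Xopt \<beta>) F)} = {Fbe}"
    if \<beta>: "(\<Sum>i=1..n. \<beta> i) = 0" for \<beta>
  proof -
    let ?X = "Xopt \<beta>"
    show alloc: "?X \<in> allocations P n X"
    proof -
      have "(\<Sum>i=1..n. ?X i \<omega>)
          = (\<Sum>i=1..n. 1 / \<gamma> i) / (\<Sum>j=1..n. 1 / \<gamma> j) * X \<omega> + (\<Sum>i=1..n. \<beta> i)" for \<omega>
        by (simp only: Xopt_def sum.distrib sum_distrib_right sum_divide_distrib)
      then have "(\<Sum>i=1..n. ?X i \<omega>) = X \<omega>" for \<omega>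
        using S \<beta> by simp
      moreover have "?X i \<in> L2 P" for i
        unfolding Xopt_def using \<open>X \<in> L2 P\<close> by (intro P.L2_add P.L2_mult P.L2_const)
      ultimately show ?thesis by (simp add: allocations_def)
    qed
    \<comment> \<open>The value is free of \<open>\<beta>\<close>, so one pair \<open>Fwo\<close>,
      \<open>Fbe\<close> serves all shifts.\<close>
    have total: "total_evaluation Q n \<gamma> ?X F = mean_variance unit_uniform \<gamma>bar (quantile F)"
      if F: "F \<in> ?\<M>" for F
      unfolding total_evaluation_def Xopt_def assms(15)
      using prob_space.sum_mean_variance_proportional[OF QX(2)[OF F] _ ne \<gamma> QX(1)[OF F] \<beta>] QX(4)[OF F]
      by simp
    \<comment> \<open>The comparison holds for each \<open>F\<close> separately, so no exchange of
      infimum and supremum is involved.\<close>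
    have "total_evaluation Q n \<gamma> ?X F \<le> total_evaluation Q n \<gamma> Y F"
      if F: "F \<in> ?\<M>" and Y: "Y \<in> allocations P n X" for F Y
    proof -
      have "(\<Sum>i=1..n. Y i \<omega>) = X \<omega>" if "\<omega> \<in> space (Q F)" for \<omega>
        using Y that QX(3)[OF F] by (simp add: allocations_def)
      then show ?thesis
        unfolding total[OF F]
        using prob_space.mean_variance_le_sum[OF QX(2)[OF F] _ ne \<gamma> QX(1)[OF F], where Y = Y] QX(4)[OF F]
        by (simp add: total_evaluation_def assms(15))
    qed
    then have "alpha_maxmin Q ?\<M> \<alpha> n \<gamma> ?X \<le> alpha_maxmin Q ?\<M> \<alpha> n \<gamma> Y"
      if "Y \<in> allocations P n X" for Y
      using that \<open>0 \<le> \<alpha>\<close> \<open>\<alpha> \<le> 1\<close> by (intro alpha_maxmin_mono)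
    then show "alpha_maxmin Q ?\<M> \<alpha> n \<gamma> ?X = (INF Y\<in>allocations P n X. alpha_maxmin Q ?\<M> \<alpha> n \<gamma> Y)"
      using alloc by (intro INF_eqI[symmetric]) auto
    show "{F \<in> ?\<M>. total_evaluation Q n \<gamma> ?X F
        = (SUP F\<in>?\<M>. total_evaluation Q n \<gamma> ?X F)} = {Fwo}"
      by (rule SUP_argmax[OF Fwo(1)]) (simp add: total Fwo)
    show "{F \<in> ?\<M>. total_evaluation Q n \<gamma> ?X F
        = (INF F\<in>?\<M>. total_evaluation Q n \<gamma> ?X F)} = {Fbe}"
      by (rule INF_argmin[OF Fbe(1)]) (simp add: total Fbe)
  qed
  show ?thesis
    unfolding Let_def Xopt_def[symmetric]
    by (rule exI[of _ \<theta>w], rule exI[of _ \<theta>b], rule exI[of _ Fwo], rule exI[of _ Fbe])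
       (intro conjI allI impI w b main; (elim conjE, intro Fwo(2) Fbe(2))?; assumption)
qed

end
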